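(* Assume that $l$ is a $\mathcal{C}^2$-function, that $h$ is a $\mathcal{C}^2$-function with respect to $\theta$, and that $\nabla_\theta h(\theta,x)$, $\nabla_\theta^2h(\theta,x)$ and the eigenvalues of the latter matrix are uniformly bounded on $\Theta\times\mathcal{X}$. Assume also that there are $r>0$, constants $0<\lambda_A\le\Lambda_A$ and, for each $\mu\in\mathcal{P}_2$, a smooth positive-definite $(d,d)$-matrix function $A_\mu(\theta)$ with $\lambda_AI_d\preceq A_\mu(\theta)\preceq\Lambda_AI_d$ such that for all $\xi\in L^2(\mu)$ with $\|\xi\|_{L^2(\mu)}<r$, $$\mathcal{L}_S((id+\xi)_\sharp\mu)\le\mathcal{L}_S(\mu)+\mathbb{E}_\mu\big[\mathbb{E}_S[s_\mu(\theta,x,y)]^\top\xi(\theta)\big]+\frac12\mathbb{E}_\mu\big[\|\xi(\theta)\|^2_{A_\mu(\theta)}\big].$$ Then there exist constants $G>0$ and $\eta_0>0$, depending on the smoothness and boundedness of $l$, $h$, $A_\mu$ and on $r$, for which the descent estimate $$\mathbb{E}_{(x',y')}\big[\mathcal{L}_S((id-\eta s_\mu(\cdot,x',y'))_\sharp\mu)\big]\le\mathcal{L}_S(\mu)-\eta\|\mathbb{E}_S[s_\mu(\theta,x,y)]\|_{L^2(\mu)}^2+\eta^2G$$ holds for all $\mu\in\mathcal{P}_2$ and $0<\eta<\eta_0$ (with $(x',y')$ uniform on $S$), and such that the following holds. Let $\epsilon>0$ and let $\eta>0$ be a constant satisfying $\eta\le\min\{\eta_0,\frac{\epsilon}{2G}\}$.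 Then SPGD started from any $\mu_0\in\mathcal{P}_2$ with constant learning rate $\eta_k=\eta$ yields an $\epsilon$-accurate solution in expectation, i.e. an iterate $\mu_k$ with $$\mathbb{E}\big[\|\mathbb{E}_S[s_{\mu_k}(\theta,x,y)]\|_{L^2(\mu_k)}^2\big]\le\epsilon$$ (the outer expectation being over the history of sampled data), within at most $$\frac{2\big(\mathcal{L}_S(\mu_0)-\inf_{\mu\in\mathcal{P}_2}\mathcal{L}_S(\mu)\big)}{\epsilon\eta}$$ iterations.
   Context: $\Theta=\mathbb{R}^d$, $\mathcal{X}\subset\mathbb{R}^n$ is Borel, $\mathcal{Y}=\{-1,1\}$; $h:\Theta\times\mathcal{X}\to[-1,1]$ is Borel measurable and continuous in $x$; $l:\mathbb{R}\to\mathbb{R}$ is a loss function. $S=\{(x_j,y_j)\}_{j=1}^N\subset\mathcal{X}\times\mathcal{Y}$ is a fixed finite dataset and $\mathbb{E}_S$ is the average over $S$ (in the variables $(x,y)$). $\mathcal{P}_2$ is the set of Borel probability measures on $\Theta$ with finite second moment. For $\mu\in\mathcal{P}_2$, $h_\mu(x)=\mathbb{E}_{\theta\sim\mu}[h(\theta,x)]$, $\mathcal{L}_S(\mu)=\frac1N\sum_{j=1}^Nl(-y_jh_\mu(x_j))$, $s_\mu(\theta,x,y)=-l'(-yh_\mu(x))\,y\,\nabla_\theta h(\theta,x)$. $L^2(\mu)$ is the space of square-$\mu$-integrable maps into $\Theta$, $\|\xi\|_{L^2(\mu)}^2=\mathbb{E}_\mu[\|\xi(\theta)\|_2^2]$;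 $\phi_\sharp\mu$ is the push-forward, $id$ the identity map, $\|v\|_A^2=v^\top Av$. SPGD (stochastic particle gradient descent; Algorithm 1 of the paper): given $\mu_0$ and learning rates $\{\eta_k\}$, at each iteration $k=0,1,\dots$ choose a sample $(x',y')$ uniformly at random from $S$ (independently of the past) and set $\mu_{k+1}=(id-\eta_ks_{\mu_k}(\cdot,x',y'))_\sharp\mu_k$. (This is the preconditioned step $-\eta A_\mu^{-1}s_\mu$ with $A_\mu$ a scalar multiple of the identity, the scalar being absorbed in the learning rate.) *)

theory Defs
  imports "HOL-Probability.Probability"
begin

section \<open>Calculus\<close>

primrec C_diff :: "nat \<Rightarrow> ('a::real_normed_vector \<Rightarrow> 'b::real_normed_vector) \<Rightarrow> bool" where
  "C_diff 0 f \<longleftrightarrow> continuous_on UNIV f"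
| "C_diff (Suc k) f \<longleftrightarrow>
     (\<forall>x. f differentiable (at x)) \<and> (\<forall>v. C_diff k (\<lambda>x. frechet_derivative f (at x) v))"

definition smooth :: "('a::real_normed_vector \<Rightarrow> 'b::real_normed_vector) \<Rightarrow> bool" where
  "smooth f \<longleftrightarrow> (\<forall>k. C_diff k f)"

definition grad :: "('a::real_inner \<Rightarrow> real) \<Rightarrow> 'a \<Rightarrow> 'a" where
  "grad f x = (SOME D. GDERIV f x :> D)"

lemma grad_eqI: "GDERIV f x :> D \<Longrightarrow> grad f x = D"
  unfolding grad_def using GDERIV_DERIV_compose gderiv_def
  by (metis (no_types, lifting) has_derivative_unique inner_commute someI vector_eq_ldot)

definition hess :: "(real^'d \<Rightarrow> real) \<Rightarrow> real^'d \<Rightarrow> real^'d^'d" where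
  "hess f x = jacobian (grad f) (at x)"


section \<open>Matrices\<close>

definition eigenvalue :: "real^'d^'d \<Rightarrow> real \<Rightarrow> bool" where
  "eigenvalue M c \<longleftrightarrow> (\<exists>v. v \<noteq> 0 \<and> M *v v = c *\<^sub>R v)"

definition pos_def :: "real^'d^'d \<Rightarrow> bool" where
  "pos_def M \<longleftrightarrow> transpose M = M \<and> (\<forall>v. v \<noteq> 0 \<longrightarrow> 0 < v \<bullet> (M *v v))"

definition pos_semidef :: "real^'d^'d \<Rightarrow> bool" where
  "pos_semidef M \<longleftrightarrow> transpose M = M \<and> (\<forall>v. 0 \<le> v \<bullet> (M *v v))"

definition loewner_le :: "real^'d^'d \<Rightarrow> real^'d^'d \<Rightarrow> bool"  (infix \<open>\<preceq>\<^sub>L\<close> 50) where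
  "M \<preceq>\<^sub>L M' \<longleftrightarrow> pos_semidef (M' - M)"


section \<open>Measures on the parameter space\<close>

definition P2 :: "('a::euclidean_space) measure set" where
  "P2 = {\<mu>. prob_space \<mu> \<and> sets \<mu> = sets borel \<and> integrable \<mu> (\<lambda>\<theta>. (norm \<theta>)\<^sup>2)}"

definition L2 :: "('a::euclidean_space) measure \<Rightarrow> ('a \<Rightarrow> 'a) set" where
  "L2 \<mu> = {\<xi>. \<xi> \<in> borel_measurable \<mu> \<and> integrable \<mu> (\<lambda>\<theta>. (norm (\<xi> \<theta>))\<^sup>2)}"

definition L2norm :: "('a::euclidean_space) measure \<Rightarrow> ('a \<Rightarrow> 'a) \<Rightarrow> real" where
  "L2norm \<mu> \<xi> = sqrt (\<integral>\<theta>. (norm (\<xi> \<theta>))\<^sup>2 \<partial>\<mu>)"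


section \<open>Empirical risk and its stochastic gradient\<close>

text \<open>A dataset is a list of pairs; repeated data points count with their multiplicity.\<close>

definition emp_avg :: "('x \<times> real) list \<Rightarrow> ('x \<Rightarrow> real \<Rightarrow> 'v::real_vector) \<Rightarrow> 'v" where
  "emp_avg S f = (1 / real (length S)) *\<^sub>R (\<Sum>(x, y)\<leftarrow>S. f x y)"

definition sample_pmf :: "('x \<times> real) list \<Rightarrow> ('x \<times> real) pmf" where
  "sample_pmf S = map_pmf (\<lambda>j. S ! j) (pmf_of_set {..<length S})"

definition h_avg :: "('a \<Rightarrow> 'x \<Rightarrow> real) \<Rightarrow> 'a measure \<Rightarrow> 'x \<Rightarrow> real" where
  "h_avg h \<mu> x = (\<integral>\<theta>. h \<theta> x \<partial>\<mu>)"

definition risk ::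
    "(real \<Rightarrow> real) \<Rightarrow> ('a \<Rightarrow> 'x \<Rightarrow> real) \<Rightarrow> ('x \<times> real) list \<Rightarrow> 'a measure \<Rightarrow> real" where
  "risk l h S \<mu> = emp_avg S (\<lambda>x y. l (- y * h_avg h \<mu> x))"

definition score ::
    "(real \<Rightarrow> real) \<Rightarrow> ('a::euclidean_space \<Rightarrow> 'x \<Rightarrow> real) \<Rightarrow> 'a measure \<Rightarrow> 'a \<Rightarrow> 'x \<Rightarrow> real \<Rightarrow> 'a"
  where
  "score l h \<mu> \<theta> x y = (- deriv l (- y * h_avg h \<mu> x) * y) *\<^sub>R grad (\<lambda>t. h t x) \<theta>"

definition mean_score ::
    "(real \<Rightarrow> real) \<Rightarrow> ('a::euclidean_space \<Rightarrow> 'x \<Rightarrow> real) \<Rightarrow> ('x \<times> real) list \<Rightarrow>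
     'a measure \<Rightarrow> 'a \<Rightarrow> 'a" where
  "mean_score l h S \<mu> \<theta> = emp_avg S (\<lambda>x y. score l h \<mu> \<theta> x y)"


section \<open>Stochastic particle gradient descent\<close>

definition spgd_step ::
    "(real \<Rightarrow> real) \<Rightarrow> ('a::euclidean_space \<Rightarrow> 'x \<Rightarrow> real) \<Rightarrow> real \<Rightarrow> 'x \<times> real \<Rightarrow>
     'a measure \<Rightarrow> 'a measure" where
  "spgd_step l h \<eta> z \<mu> = distr \<mu> borel (\<lambda>\<theta>. \<theta> - \<eta> *\<^sub>R score l h \<mu> \<theta> (fst z) (snd z))"

text \<open>The \<open>k\<close>-th iterate, as a function of the sampled sequence \<open>\<omega>\<close> of data points.\<close>

primrec spgd ::
    "(real \<Rightarrow> real) \<Rightarrow> ('a::euclidean_space \<Rightarrow> 'x \<Rightarrow> real) \<Rightarrow> (nat \<Rightarrow> real) \<Rightarrow> 'a measure \<Rightarrow>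
     (nat \<Rightarrow> 'x \<times> real) \<Rightarrow> nat \<Rightarrow> 'a measure" where
  "spgd l h \<eta> \<mu>0 \<omega> 0 = \<mu>0"
| "spgd l h \<eta> \<mu>0 \<omega> (Suc k) = spgd_step l h (\<eta> k) (\<omega> k) (spgd l h \<eta> \<mu>0 \<omega> k)"

definition sample_space :: "('x \<times> real) list \<Rightarrow> (nat \<Rightarrow> 'x \<times> real) measure" where
  "sample_space S = (\<Pi>\<^sub>M k\<in>UNIV. measure_pmf (sample_pmf S))"


section \<open>Quantitative regularity\<close>

text \<open>
  The arguments \<open>- y * h_avg h \<mu> x\<close> of the loss all lie in \<open>[-1, 1]\<close>, so only the size of the
  derivatives of \<open>l\<close> there is relevant; it is finite for every \<open>l\<close> of class \<open>C\<^sup>2\<close>.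
\<close>

definition regularity_bounds ::
    "(real \<Rightarrow> real) \<Rightarrow> (real^'d \<Rightarrow> 'x \<Rightarrow> real) \<Rightarrow> 'x set \<Rightarrow> real \<times> real \<times> real \<times> real" where
  "regularity_bounds l h X =
     (SUP u\<in>{-1..1}. \<bar>deriv l u\<bar>,
      SUP u\<in>{-1..1}. \<bar>deriv (deriv l) u\<bar>,
      SUP (\<theta>, x)\<in>UNIV \<times> X. norm (grad (\<lambda>t. h t x) \<theta>),
      SUP (\<theta>, x)\<in>UNIV \<times> X. norm (hess (\<lambda>t. h t x) \<theta>))"

end

theory Submission
  imports Defs
begin

text \<open>
  On the dataset the scores are bounded by \<open>M = L * B\<close>, where \<open>L\<close> bounds \<open>\<bar>l'\<bar>\<close> on \<open>[-1, 1]\<close> and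
  \<open>B\<close> bounds the gradients of \<open>h\<close>. Hence for \<open>\<eta> * M < r\<close> the quadratic upper bound on the risk
  applies to \<open>\<xi> = - \<eta> * score\<close>; its second-order term is at most \<open>\<eta>\<^sup>2 * LamA * M\<^sup>2 / 2\<close>, and
  averaging its first-order term over the data gives minus \<open>\<eta>\<close> times the squared norm of the mean
  score. If no iterate up to step \<open>K\<close> were accurate, telescoping the expected descent would push
  the expected risk below its infimum.
\<close>

section \<open>Gradients of continuously differentiable functions\<close>

text \<open>Expanding \<open>v\<close> in the orthonormal basis and using linearity of the
  derivative yields its Riesz representative, with the directional derivatives as
  coordinates.\<close>

lemma GDERIV_frechet_derivative:
  fixes f :: "'a::euclidean_space \<Rightarrow> real"
  assumes "f differentiable (at x)"
  shows "GDERIV f x :> (\<Sum>b\<in>Basis. frechet_derivative f (at x) b *\<^sub>R b)"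
proof -
  have d: "(f has_derivative frechet_derivative f (at x)) (at x)"
    using assms by (simp add: frechet_derivative_works)
  interpret F: bounded_linear "frechet_derivative f (at x)"
    using d by (rule has_derivative_bounded_linear)
  have "frechet_derivative f (at x) = (\<lambda>v. v \<bullet> (\<Sum>b\<in>Basis. frechet_derivative f (at x) b *\<^sub>R b))"
  proof
    fix v
    have "frechet_derivative f (at x) v
        = frechet_derivative f (at x) (\<Sum>b\<in>Basis. (v \<bullet> b) *\<^sub>R b)"
      by (simp add: euclidean_representation)
    also have "\<dots> = (\<Sum>b\<in>Basis. (v \<bullet> b) * frechet_derivative f (at x) b)"
      by (simp add: F.sum F.scaleR)
    finally show "frechet_derivative f (at x) v
        = v \<bullet> (\<Sum>b\<in>Basis. frechet_derivative f (at x) b *\<^sub>R b)"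
      by (simp add: inner_sum_right mult.commute)
  qed
  with d have "(f has_derivative (\<lambda>v. v \<bullet> (\<Sum>b\<in>Basis. frechet_derivative f (at x) b *\<^sub>R b))) (at x)"
    by metis
  then show ?thesis
    unfolding gderiv_def .
qed

lemma C_diff_2_differentiable: "C_diff 2 f \<Longrightarrow> f differentiable (at x)"
  by (simp add: numeral_2_eq_2)

lemma C_diff_2_continuous_on: "C_diff 2 f \<Longrightarrow> continuous_on A f"
  by (intro continuous_at_imp_continuous_on ballI differentiable_imp_continuous_within
      C_diff_2_differentiable)

lemma C_diff_2_continuous_on_frechet_derivative:
  assumes "C_diff 2 f"
  shows "continuous_on A (\<lambda>x. frechet_derivative f (at x) v)"
proof (rule continuous_at_imp_continuous_on, rule ballI, rule differentiable_imp_continuous_within)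
  show "(\<lambda>x. frechet_derivative f (at x) v) differentiable (at x)" for x
    using assms by (simp add: numeral_2_eq_2)
qed

text \<open>\<open>grad\<close> is a choice, so it is first identified with the explicit basis
  formula, whose coefficients are continuous. Continuity later gives measurability of the scores in
  \<theta>.\<close>

lemma C_diff_2_continuous_on_grad:
  fixes f :: "'a::euclidean_space \<Rightarrow> real"
  assumes "C_diff 2 f"
  shows "continuous_on A (grad f)"
proof -
  have "grad f = (\<lambda>x. \<Sum>b\<in>Basis. frechet_derivative f (at x) b *\<^sub>R b)"
    by (rule ext, rule grad_eqI, rule GDERIV_frechet_derivative)
      (rule C_diff_2_differentiable[OF assms])
  then show ?thesis
    by (simp only:) (intro continuous_on_sum continuous_on_scaleR continuous_on_const
        C_diff_2_continuous_on_frechet_derivative assms)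
qed

text \<open>The scalar derivative is the Frechet derivative in direction 1. With compactness of
  \<open>{-1..1}\<close> this makes the supremum of |l'| there finite.\<close>

lemma C_diff_2_continuous_on_deriv:
  fixes f :: "real \<Rightarrow> real"
  assumes "C_diff 2 f"
  shows "continuous_on A (deriv f)"
proof -
  have "deriv f = (\<lambda>x. frechet_derivative f (at x) 1)"
  proof
    fix x
    have "(f has_derivative (*) (deriv f x)) (at x)"
      using iffD2[OF DERIV_deriv_iff_real_differentiable C_diff_2_differentiable[OF assms]]
      unfolding has_field_derivative_def .
    then have "(*) (deriv f x) = frechet_derivative f (at x)"
      by (rule frechet_derivative_at)
    then show "deriv f x = frechet_derivative f (at x) 1"
      by (auto dest: fun_cong[where x=1])
  qed
  then show ?thesis
    using C_diff_2_continuous_on_frechet_derivative[OF assms] by simp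
qed

text \<open>Tests the positive semidefinite difference on \<open>v\<close>; this controls the
  second-order term of the descent.\<close>

lemma loewner_le_mat_inner:
  fixes M :: "real^'d^'d"
  assumes "M \<preceq>\<^sub>L mat c"
  shows "v \<bullet> (M *v v) \<le> c * (norm v)\<^sup>2"
proof -
  have "0 \<le> v \<bullet> ((mat c - M) *v v)"
    using assms by (simp add: loewner_le_def pos_semidef_def)
  moreover have "mat c *v v = c *\<^sub>R v"
    by (simp add: vec_eq_iff matrix_vector_mult_def mat_def if_distrib if_distribR
        cong: if_cong)
  ultimately show ?thesis
    by (simp add: matrix_vector_mult_diff_rdistrib inner_diff_right power2_norm_eq_inner)
qed

lemma power2_L2norm: "(L2norm \<mu> \<xi>)\<^sup>2 = (\<integral>\<theta>. (norm (\<xi> \<theta>))\<^sup>2 \<partial>\<mu>)"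
  by (simp add: L2norm_def integral_nonneg_AE)

section \<open>Empirical averages\<close>

text \<open>Summing over positions keeps the multiplicity of repeated data points and makes facts
  about finite sums applicable.\<close>

lemma emp_avg_eq_sum:
  "emp_avg S f = (1 / real (length S)) *\<^sub>R (\<Sum>i<length S. f (fst (S ! i)) (snd (S ! i)))"
  by (simp add: emp_avg_def sum_list_sum_nth case_prod_beta atLeast0LessThan)

lemma emp_avg_const: "S \<noteq> [] \<Longrightarrow> emp_avg S (\<lambda>x y. c) = c"
  by (simp add: emp_avg_eq_sum sum_constant_scaleR)

lemma emp_avg_add: "emp_avg S (\<lambda>x y. f x y + g x y) = emp_avg S f + emp_avg S g"
  by (simp add: emp_avg_eq_sum sum.distrib scaleR_add_right)

lemma emp_avg_bounded_linear:
  assumes "bounded_linear L"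
  shows "emp_avg S (\<lambda>x y. L (f x y)) = L (emp_avg S f)"
proof -
  interpret L: bounded_linear L by fact
  show ?thesis by (simp add: emp_avg_eq_sum L.sum L.scaleR)
qed

lemma emp_avg_cong:
  assumes "\<And>x y. (x, y) \<in> set S \<Longrightarrow> f x y = g x y"
  shows "emp_avg S f = emp_avg S g"
  unfolding emp_avg_eq_sum using assms
  by (intro arg_cong[where f="\<lambda>v. _ *\<^sub>R v"] sum.cong) auto

lemma emp_avg_mono:
  fixes f g :: "'x \<Rightarrow> real \<Rightarrow> real"
  assumes "\<And>x y. (x, y) \<in> set S \<Longrightarrow> f x y \<le> g x y"
  shows "emp_avg S f \<le> emp_avg S g"
  unfolding emp_avg_eq_sum using assms
  by (intro scaleR_left_mono sum_mono) auto

lemma norm_emp_avg_le: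
  fixes f :: "'x \<Rightarrow> real \<Rightarrow> 'v::real_normed_vector"
  assumes "S \<noteq> []" "\<And>x y. (x, y) \<in> set S \<Longrightarrow> norm (f x y) \<le> B"
  shows "norm (emp_avg S f) \<le> B"
proof -
  have "norm (\<Sum>i<length S. f (fst (S ! i)) (snd (S ! i))) \<le> (\<Sum>i<length S. B)"
    using assms(2) by (intro sum_norm_le) auto
  then show ?thesis
    using assms(1) by (simp add: emp_avg_eq_sum field_simps)
qed

lemma borel_measurable_emp_avg:
  fixes f :: "'a \<Rightarrow> 'x \<Rightarrow> real \<Rightarrow> 'v::euclidean_space"
  assumes "\<And>x y. (x, y) \<in> set S \<Longrightarrow> (\<lambda>\<theta>. f \<theta> x y) \<in> borel_measurable M"
  shows "(\<lambda>\<theta>. emp_avg S (f \<theta>)) \<in> borel_measurable M"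
  unfolding emp_avg_eq_sum using assms
  by (intro borel_measurable_scaleR borel_measurable_const borel_measurable_sum) auto

lemma emp_avg_integral:
  fixes f :: "'a \<Rightarrow> 'x \<Rightarrow> real \<Rightarrow> 'v::euclidean_space"
  assumes "\<And>x y. (x, y) \<in> set S \<Longrightarrow> integrable M (\<lambda>\<theta>. f \<theta> x y)"
  shows "emp_avg S (\<lambda>x y. \<integral>\<theta>. f \<theta> x y \<partial>M) = (\<integral>\<theta>. emp_avg S (f \<theta>) \<partial>M)"
  unfolding emp_avg_eq_sum using assms by (simp add: integral_sum)

section \<open>Uniform sampling from the dataset\<close>

lemma set_pmf_sample_pmf: "S \<noteq> [] \<Longrightarrow> set_pmf (sample_pmf S) = set S"
  by (auto simp: sample_pmf_def set_conv_nth lessThan_empty_iff set_pmf_of_set)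

lemma integral_sample_pmf:
  fixes f :: "'x \<times> real \<Rightarrow> real"
  assumes "S \<noteq> []"
  shows "(\<integral>z. f z \<partial>measure_pmf (sample_pmf S)) = emp_avg S (\<lambda>x y. f (x, y))"
  using assms
  by (simp add: sample_pmf_def integral_pmf_of_set lessThan_empty_iff emp_avg_eq_sum)

section \<open>Expectations along the random iteration\<close>

text \<open>The k-th power of the Markov transition operator of the iteration, applied to
  \<open>\<Phi>\<close>: the expected value of \<open>\<Phi>\<close> at the k-th iterate started
  from \<open>\<mu>\<close>. Built from finite averages, it raises no question of
  measurability.\<close>

primrec iter_mean ::
    "(real \<Rightarrow> real) \<Rightarrow> ('a::euclidean_space \<Rightarrow> 'x \<Rightarrow> real) \<Rightarrow> ('x \<times> real) list \<Rightarrow> real \<Rightarrow>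
     ('a measure \<Rightarrow> real) \<Rightarrow> nat \<Rightarrow> 'a measure \<Rightarrow> real" where
  "iter_mean l h S \<eta> \<Phi> 0 \<mu> = \<Phi> \<mu>"
| "iter_mean l h S \<eta> \<Phi> (Suc k) \<mu>
     = emp_avg S (\<lambda>x y. iter_mean l h S \<eta> \<Phi> k (spgd_step l h \<eta> (x, y) \<mu>))"

text \<open>The recursion of \<open>spgd\<close> peels off the last sample; splitting off the first
  one matches the recursion of \<open>iter_mean\<close>.\<close>

lemma spgd_Suc_shift:
  "spgd l h (\<lambda>_. \<eta>) \<mu> \<omega> (Suc k) = spgd l h (\<lambda>_. \<eta>) (spgd_step l h \<eta> (\<omega> 0) \<mu>) (\<lambda>i. \<omega> (Suc i)) k"
  by (induction k) auto

text \<open>Only finitely many pairs of sample and previous iterate can occur. Hence every real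
  functional of the k-th iterate is bounded.\<close>

lemma finite_range_spgd:
  assumes "finite Z" "\<And>\<omega> i. p \<omega> i \<in> Z"
  shows "finite (range (\<lambda>\<omega>. spgd l h \<eta> \<mu> (p \<omega>) k))"
proof (induction k)
  case (Suc k)
  have "range (\<lambda>\<omega>. spgd l h \<eta> \<mu> (p \<omega>) (Suc k))
      \<subseteq> (\<lambda>(z, \<nu>). spgd_step l h (\<eta> k) z \<nu>) ` (Z \<times> range (\<lambda>\<omega>. spgd l h \<eta> \<mu> (p \<omega>) k))"
    using assms(2) by auto
  then show ?case
    using Suc assms(1) by (meson finite_SigmaI finite_imageI finite_subset)
qed auto

text \<open>The target carries the discrete sigma-algebra, so every real functional of the iterate
  becomes measurable, without a topology on measures.\<close>

lemma measurable_spgd: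
  assumes "countable Z" "\<And>i. (\<lambda>\<omega>. p \<omega> i) \<in> measurable M (count_space Z)"
  shows "(\<lambda>\<omega>. spgd l h \<eta> \<mu> (p \<omega>) k) \<in> measurable M (count_space UNIV)"
proof (induction k)
  case (Suc k)
  have "(\<lambda>\<omega>. spgd_step l h (\<eta> k) z (spgd l h \<eta> \<mu> (p \<omega>) k)) \<in> measurable M (count_space UNIV)" for z
    by (rule measurable_compose[OF Suc]) simp
  \<comment> \<open>Case distinction over the countably many values of the k-th sample.\<close>
  then have "(\<lambda>\<omega>. spgd_step l h (\<eta> k) (p \<omega> k) (spgd l h \<eta> \<mu> (p \<omega>) k))
      \<in> measurable M (count_space UNIV)"
    by (rule measurable_compose_countable'[OF _ assms(2) assms(1)])
  then show ?case by simp
qed auto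

text \<open>
  The sample space contains sequences leaving the dataset, on which the iterates are arbitrary.
  Projecting the samples onto the dataset changes nothing almost surely and makes the iterates
  measurable functions with finite range.
\<close>

definition snap :: "'z list \<Rightarrow> 'z \<Rightarrow> 'z" where
  "snap S z = (if z \<in> set S then z else hd S)"

lemma snap_in: "S \<noteq> [] \<Longrightarrow> snap S z \<in> set S"
  by (simp add: snap_def)

lemma prob_space_sample_space: "prob_space (sample_space S)"
  unfolding sample_space_def by (intro prob_space_PiM measure_pmf.prob_space_axioms)

lemma measurable_snap_sample_space:
  assumes "S \<noteq> []"
  shows "(\<lambda>\<omega>. snap S (\<omega> i)) \<in> measurable (sample_space S) (count_space (set S))"
proof -
  have "(\<lambda>\<omega>. \<omega> i) \<in> measurable (sample_space S) (measure_pmf (sample_pmf S))"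
    unfolding sample_space_def by (rule measurable_component_singleton) simp
  moreover have "snap S \<in> measurable (measure_pmf (sample_pmf S)) (count_space (set S))"
    using snap_in[OF assms] by (auto simp: measurable_def)
  ultimately show ?thesis by (rule measurable_compose)
qed

lemma measurable_functional_spgd:
  assumes "S \<noteq> []"
  shows "(\<lambda>\<omega>. \<Phi> (spgd l h \<eta> \<mu> (\<lambda>i. snap S (\<omega> i)) k)) \<in> borel_measurable (sample_space S)"
proof -
  have "(\<lambda>\<omega>. spgd l h \<eta> \<mu> (\<lambda>i. snap S (\<omega> i)) k) \<in> measurable (sample_space S) (count_space UNIV)"
    using assms by (intro measurable_spgd[where Z="set S"] measurable_snap_sample_space)
      (simp_all add: countable_finite)
  then show ?thesis
    by (rule measurable_compose[where g=\<Phi>]) simp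
qed

lemma integrable_functional_spgd:
  fixes \<Phi> :: "'a::euclidean_space measure \<Rightarrow> real"
  assumes "S \<noteq> []"
  shows "integrable (sample_space S) (\<lambda>\<omega>. \<Phi> (spgd l h \<eta> \<mu> (\<lambda>i. snap S (\<omega> i)) k))"
proof -
  interpret prob_space "sample_space S" by (rule prob_space_sample_space)
  have "finite (range (\<lambda>\<omega>. spgd l h \<eta> \<mu> (\<lambda>i. snap S (\<omega> i)) k))"
    using snap_in[OF assms] by (intro finite_range_spgd[where Z="set S"]) auto
  then have "finite ((\<lambda>\<nu>. norm (\<Phi> \<nu>)) ` range (\<lambda>\<omega>. spgd l h \<eta> \<mu> (\<lambda>i. snap S (\<omega> i)) k))"
    by (rule finite_imageI)
  then obtain B where "\<And>\<omega>. norm (\<Phi> (spgd l h \<eta> \<mu> (\<lambda>i. snap S (\<omega> i)) k)) \<le> B"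
    by (metis bdd_above_finite bdd_above.E imageI rangeI)
  then show ?thesis
    by (intro integrable_const_bound[where B=B] measurable_functional_spgd assms) simp
qed

text \<open>Independence of the samples enters here: the sequence space is its first coordinate
  times a copy of itself, and Fubini integrates the first sample last. The start
  \<open>\<mu>\<close> varies in the induction because the first step moves it.\<close>

lemma integral_snapped_spgd:
  fixes \<Phi> :: "'a::euclidean_space measure \<Rightarrow> real"
  assumes "S \<noteq> []"
  shows "(\<integral>\<omega>. \<Phi> (spgd l h (\<lambda>_. \<eta>) \<mu> (\<lambda>i. snap S (\<omega> i)) k) \<partial>sample_space S)
     = iter_mean l h S \<eta> \<Phi> k \<mu>"
proof (induction k arbitrary: \<mu>)
  case 0
  interpret prob_space "sample_space S" by (rule prob_space_sample_space)
  show ?case by (simp add: prob_space)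
next
  case (Suc k)
  let ?M = "measure_pmf (sample_pmf S)"
  let ?F = "\<lambda>\<omega>. \<Phi> (spgd l h (\<lambda>_. \<eta>) \<mu> (\<lambda>i. snap S (\<omega> i)) (Suc k))"
  interpret sequence_space ?M ..
  interpret Q: prob_space "sample_space S" by (rule prob_space_sample_space)
  interpret PP: pair_sigma_finite ?M "sample_space S" ..
  \<comment> \<open>Prepending an independent sample to a random sequence reproduces the law of the
    sequence.\<close>
  have iter: "distr (?M \<Otimes>\<^sub>M sample_space S) (sample_space S) (\<lambda>(z, \<omega>). case_nat z \<omega>)
      = sample_space S"
    unfolding sample_space_def using PiM_iter .
  have meas: "(\<lambda>(z, \<omega>). case_nat z \<omega>) \<in> measurable (?M \<Otimes>\<^sub>M sample_space S) (sample_space S)"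
    unfolding sample_space_def by measurable
  have "integrable (distr (?M \<Otimes>\<^sub>M sample_space S) (sample_space S) (\<lambda>(z, \<omega>). case_nat z \<omega>)) ?F"
    unfolding iter using assms by (rule integrable_functional_spgd)
  then have int: "integrable (?M \<Otimes>\<^sub>M sample_space S) (\<lambda>w. ?F (case w of (z, \<omega>) \<Rightarrow> case_nat z \<omega>))"
    by (rule integrable_distr[OF meas])
  have "(\<integral>\<omega>. ?F \<omega> \<partial>sample_space S)
      = (\<integral>w. ?F (case w of (z, \<omega>) \<Rightarrow> case_nat z \<omega>) \<partial>(?M \<Otimes>\<^sub>M sample_space S))"
    by (subst iter[symmetric], rule integral_distr[OF meas])
      (rule measurable_functional_spgd[OF assms])
  also have "\<dots> = (\<integral>z. (\<integral>\<omega>. ?F (case_nat z \<omega>) \<partial>sample_space S) \<partial>?M)"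
    using PP.integral_fst'[OF int] by simp
  also have "\<dots> = (\<integral>z. iter_mean l h S \<eta> \<Phi> k (spgd_step l h \<eta> (snap S z) \<mu>) \<partial>?M)"
    unfolding spgd_Suc_shift by (simp add: Suc.IH)
  \<comment> \<open>The integral over \<open>z\<close> is a data average, and \<open>snap\<close>
    fixes data points.\<close>
  also have "\<dots> = iter_mean l h S \<eta> \<Phi> (Suc k) \<mu>"
    using assms by (auto simp: integral_sample_pmf snap_def intro!: emp_avg_cong)
  finally show ?case .
qed

text \<open>Since \<open>P\<close> is stable under every step, the comparison on \<open>P\<close>
  suffices. It serves with \<open>P2\<close> for the risk and with \<open>UNIV\<close> for
  nonnegativity.\<close>

lemma iter_mean_mono:
  assumes step: "\<And>\<mu> x y. \<mu> \<in> P \<Longrightarrow> (x, y) \<in> set S \<Longrightarrow> spgd_step l h \<eta> (x, y) \<mu> \<in> P"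
    and le: "\<And>\<mu>. \<mu> \<in> P \<Longrightarrow> \<Phi> \<mu> \<le> \<Psi> \<mu>"
    and "\<mu> \<in> P"
  shows "iter_mean l h S \<eta> \<Phi> k \<mu> \<le> iter_mean l h S \<eta> \<Psi> k \<mu>"
  using \<open>\<mu> \<in> P\<close>
proof (induction k arbitrary: \<mu>)
  case (Suc k)
  then show ?case by (simp add: emp_avg_mono step)
qed (simp add: le)

lemma iter_mean_const: "S \<noteq> [] \<Longrightarrow> iter_mean l h S \<eta> (\<lambda>_. c) k \<mu> = c"
  by (induction k arbitrary: \<mu>) (simp_all add: emp_avg_const)

lemma iter_mean_add:
  "iter_mean l h S \<eta> (\<lambda>\<mu>. \<Phi> \<mu> + \<Psi> \<mu>) k \<mu> = iter_mean l h S \<eta> \<Phi> k \<mu> + iter_mean l h S \<eta> \<Psi> k \<mu>"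
  by (induction k arbitrary: \<mu>) (simp_all add: emp_avg_add)

lemma iter_mean_mult:
  "iter_mean l h S \<eta> (\<lambda>\<mu>. c * \<Phi> \<mu>) k \<mu> = c * iter_mean l h S \<eta> \<Phi> k \<mu>"
  by (induction k arbitrary: \<mu>)
    (simp_all add: emp_avg_bounded_linear[OF bounded_linear_mult_right])

text \<open>The defining recursion averages over the first step; powers of the transition operator
  commute with it, so the last step can be split off instead. In this form a one-step estimate
  applies to the last step.\<close>

lemma iter_mean_Suc:
  "iter_mean l h S \<eta> \<Phi> (Suc k) \<mu>
     = iter_mean l h S \<eta> (\<lambda>\<nu>. emp_avg S (\<lambda>x y. \<Phi> (spgd_step l h \<eta> (x, y) \<nu>))) k \<mu>"
  by (induction k arbitrary: \<mu>) simp_all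

text \<open>
  The product of power set sigma-algebras of an uncountable type need not contain all sets, so the
  integrand may fail to be measurable; its integral is then \<open>0\<close>, whence only an inequality, for
  nonnegative \<open>\<Phi>\<close>.
\<close>

lemma integral_spgd_le:
  fixes \<Phi> :: "'a::euclidean_space measure \<Rightarrow> real"
  assumes "S \<noteq> []" and nonneg: "\<And>\<mu>. 0 \<le> \<Phi> \<mu>"
  shows "(\<integral>\<omega>. \<Phi> (spgd l h (\<lambda>_. \<eta>) \<mu> \<omega> k) \<partial>sample_space S) \<le> iter_mean l h S \<eta> \<Phi> k \<mu>"
proof (cases "integrable (sample_space S) (\<lambda>\<omega>. \<Phi> (spgd l h (\<lambda>_. \<eta>) \<mu> \<omega> k))")
  case True
  have "AE \<omega> in sample_space S. \<omega> i \<in> set S" for i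
    unfolding sample_space_def
    by (rule AE_PiM_component)
      (auto simp: AE_measure_pmf_iff set_pmf_sample_pmf assms measure_pmf.prob_space_axioms)
  then have "AE \<omega> in sample_space S. \<forall>i. \<omega> i \<in> set S"
    by (simp add: AE_all_countable)
  then have "AE \<omega> in sample_space S.
      \<Phi> (spgd l h (\<lambda>_. \<eta>) \<mu> \<omega> k) = \<Phi> (spgd l h (\<lambda>_. \<eta>) \<mu> (\<lambda>i. snap S (\<omega> i)) k)"
    by eventually_elim (simp add: snap_def)
  then have "(\<integral>\<omega>. \<Phi> (spgd l h (\<lambda>_. \<eta>) \<mu> \<omega> k) \<partial>sample_space S)
      = (\<integral>\<omega>. \<Phi> (spgd l h (\<lambda>_. \<eta>) \<mu> (\<lambda>i. snap S (\<omega> i)) k) \<partial>sample_space S)"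
    using True measurable_functional_spgd[OF assms(1)] by (intro integral_cong_AE) auto
  then show ?thesis
    using integral_snapped_spgd[OF assms(1), of \<Phi> l h \<eta> \<mu> k] by simp
next
  case False
  have "0 \<le> iter_mean l h S \<eta> \<Phi> k \<mu>"
    using iter_mean_mono[of UNIV S l h \<eta> "\<lambda>_. 0" \<Phi> \<mu> k] nonneg assms(1)
    by (simp add: iter_mean_const)
  with False show ?thesis by (simp add: not_integrable_integral_eq)
qed

section \<open>Expected descent\<close>

text \<open>What the descent argument uses of \<open>l\<close> and \<open>h\<close>, stated at the
  data points: \<open>L\<close> bounds |l'| on the range of the margins and \<open>B\<close> the
  gradients.\<close>

locale bounded_score =
  fixes l :: "real \<Rightarrow> real" and h :: "'a::euclidean_space \<Rightarrow> 'x \<Rightarrow> real"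
    and S :: "('x \<times> real) list" and L B :: real
  assumes nonempty: "S \<noteq> []"
    and label: "\<And>x y. (x, y) \<in> set S \<Longrightarrow> y \<in> {-1, 1}"
    and h_range: "\<And>x y \<theta>. (x, y) \<in> set S \<Longrightarrow> h \<theta> x \<in> {-1..1}"
    and grad_measurable:
      "\<And>x y. (x, y) \<in> set S \<Longrightarrow> grad (\<lambda>t. h t x) \<in> borel_measurable borel"
    and grad_bound: "\<And>x y \<theta>. (x, y) \<in> set S \<Longrightarrow> norm (grad (\<lambda>t. h t x) \<theta>) \<le> B"
    and deriv_bound: "\<And>u. u \<in> {-1..1} \<Longrightarrow> \<bar>deriv l u\<bar> \<le> L"
    and loss_continuous: "continuous_on {-1..1} l"
begin

abbreviation sq_norm_mean_score :: "'a measure \<Rightarrow> real" where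
  "sq_norm_mean_score \<mu> \<equiv> (L2norm \<mu> (mean_score l h S \<mu>))\<^sup>2"

section \<open>Integration against measures with finite second moment\<close>

lemma P2_measurable: "\<mu> \<in> P2 \<Longrightarrow> f \<in> borel_measurable borel \<Longrightarrow> f \<in> borel_measurable \<mu>"
  by (simp add: P2_def cong: measurable_cong_sets)

lemma P2_integrable_bounded:
  fixes f :: "'a \<Rightarrow> 'b::{banach, second_countable_topology}"
  assumes "\<mu> \<in> P2" "f \<in> borel_measurable borel" "\<And>\<theta>. norm (f \<theta>) \<le> c"
  shows "integrable \<mu> f"
proof -
  interpret prob_space \<mu> using assms(1) by (simp add: P2_def)
  show ?thesis
    using assms P2_measurable by (intro integrable_const_bound[where B=c]) auto
qed

text \<open>A non-integrable \<open>f\<close> has integral 0 by convention, which is why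
  \<open>c\<close> is taken nonnegative.\<close>

lemma P2_integral_le:
  fixes f :: "'a \<Rightarrow> real"
  assumes "\<mu> \<in> P2" "0 \<le> c" "\<And>\<theta>. f \<theta> \<le> c"
  shows "(\<integral>\<theta>. f \<theta> \<partial>\<mu>) \<le> c"
proof -
  interpret prob_space \<mu> using assms(1) by (simp add: P2_def)
  have "(\<integral>\<theta>. f \<theta> \<partial>\<mu>) \<le> (\<integral>\<theta>. c \<partial>\<mu>)"
    by (rule integral_mono_AE') (use assms in auto)
  then show ?thesis by (simp add: prob_space)
qed

text \<open>Averages of values in \<open>[-1, 1]\<close> stay there and labels are signs, so l' is
  evaluated only where \<open>L\<close> bounds it.\<close>

lemma margin_range:
  assumes "\<mu> \<in> P2" "(x, y) \<in> set S"
  shows "- y * h_avg h \<mu> x \<in> {-1..1}"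
proof -
  have h: "- 1 \<le> h \<theta> x" "h \<theta> x \<le> 1" for \<theta>
    using h_range[OF assms(2)] by auto
  have "h_avg h \<mu> x \<le> 1"
    unfolding h_avg_def using assms(1) h by (intro P2_integral_le) auto
  \<comment> \<open>The lower bound is the upper bound for \<open>- h\<close>.\<close>
  moreover have "(\<integral>\<theta>. - h \<theta> x \<partial>\<mu>) \<le> 1"
    using h(1) by (intro P2_integral_le[OF assms(1)]) (auto simp: minus_le_iff)
  ultimately show ?thesis
    using label[OF assms(2)] by (auto simp: h_avg_def)
qed

section \<open>Bounds on the scores\<close>

lemma L_nonneg: "0 \<le> L"
  using deriv_bound[of 0] by auto

lemma B_nonneg: "0 \<le> B"
proof -
  obtain x y where "(x, y) \<in> set S" using nonempty by (cases S) auto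
  then show ?thesis using grad_bound norm_ge_zero order_trans by blast
qed

lemma score_measurable:
  "(x, y) \<in> set S \<Longrightarrow> (\<lambda>\<theta>. score l h \<mu> \<theta> x y) \<in> borel_measurable borel"
  unfolding score_def using grad_measurable by measurable

lemma norm_score_le:
  assumes "\<mu> \<in> P2" "(x, y) \<in> set S"
  shows "norm (score l h \<mu> \<theta> x y) \<le> L * B"
proof -
  have "\<bar>y\<bar> = 1" using label[OF assms(2)] by auto
  then have "norm (score l h \<mu> \<theta> x y)
      = \<bar>deriv l (- y * h_avg h \<mu> x)\<bar> * norm (grad (\<lambda>t. h t x) \<theta>)"
    by (simp add: score_def abs_mult)
  also have "\<dots> \<le> L * B"
    using deriv_bound[OF margin_range[OF assms]] grad_bound[OF assms(2)] L_nonneg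
    by (intro mult_mono) auto
  finally show ?thesis .
qed

lemma mean_score_measurable: "mean_score l h S \<mu> \<in> borel_measurable borel"
  unfolding mean_score_def[abs_def] by (intro borel_measurable_emp_avg score_measurable)

lemma norm_mean_score_le: "\<mu> \<in> P2 \<Longrightarrow> norm (mean_score l h S \<mu> \<theta>) \<le> L * B"
  unfolding mean_score_def by (intro norm_emp_avg_le nonempty norm_score_le)

text \<open>The displacement is bounded, so the second moment stays finite; all iterates remain
  where the descent estimate holds.\<close>

lemma spgd_step_in_P2:
  assumes "\<mu> \<in> P2" "(x, y) \<in> set S"
  shows "spgd_step l h \<eta> (x, y) \<mu> \<in> P2"
proof -
  define T where "T \<theta> = \<theta> - \<eta> *\<^sub>R score l h \<mu> \<theta> x y" for \<theta>
  interpret prob_space \<mu> using assms(1) by (simp add: P2_def)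
  have "T \<in> borel_measurable borel"
    unfolding T_def[abs_def] using score_measurable[OF assms(2)] by measurable
  then have T: "T \<in> borel_measurable \<mu>"
    by (rule P2_measurable[OF assms(1)])
  have le: "(norm (T \<theta>))\<^sup>2 \<le> 2 * (norm \<theta>)\<^sup>2 + 2 * (\<eta> * (L * B))\<^sup>2" for \<theta>
  proof -
    have "norm (T \<theta>) \<le> norm \<theta> + \<bar>\<eta>\<bar> * (L * B)"
      using norm_triangle_ineq4[of \<theta> "\<eta> *\<^sub>R score l h \<mu> \<theta> x y"]
        mult_left_mono[OF norm_score_le[OF assms, of \<theta>], of "\<bar>\<eta>\<bar>"]
      unfolding T_def by simp
    then have "(norm (T \<theta>))\<^sup>2 \<le> (norm \<theta> + \<bar>\<eta>\<bar> * (L * B))\<^sup>2"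
      by (intro power_mono) auto
    \<comment> \<open>By \<open>2ab \<le> a^2 + b^2\<close>. The first summand is integrable by the
      moment condition on \<open>\<mu>\<close>, the second is constant.\<close>
    also have "\<dots> \<le> 2 * (norm \<theta>)\<^sup>2 + 2 * (\<bar>\<eta>\<bar> * (L * B))\<^sup>2"
      using sum_squares_bound[of "norm \<theta>" "\<bar>\<eta>\<bar> * (L * B)"] by (simp add: power2_sum)
    finally show ?thesis by (simp add: power_mult_distrib)
  qed
  have "integrable \<mu> (\<lambda>\<theta>. (norm (T \<theta>))\<^sup>2)"
  proof (rule Bochner_Integration.integrable_bound)
    show "integrable \<mu> (\<lambda>\<theta>. 2 * (norm \<theta>)\<^sup>2 + 2 * (\<eta> * (L * B))\<^sup>2)"
      using assms(1) by (intro Bochner_Integration.integrable_add integrable_mult_right)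
        (auto simp: P2_def)
    show "AE \<theta> in \<mu>. norm ((norm (T \<theta>))\<^sup>2) \<le> norm (2 * (norm \<theta>)\<^sup>2 + 2 * (\<eta> * (L * B))\<^sup>2)"
      using le by (simp add: abs_of_nonneg)
  qed (use T in measurable)
  moreover have "spgd_step l h \<eta> (x, y) \<mu> = distr \<mu> borel T"
    by (simp add: spgd_step_def T_def[abs_def])
  ultimately show ?thesis
    using T by (simp add: P2_def prob_space_distr integrable_distr_eq)
qed

text \<open>The margins lie in a compact interval on which \<open>l\<close> is continuous. This
  makes the infimum over \<open>P2\<close> a genuine lower bound.\<close>

lemma risk_bounded_below: "\<exists>m. \<forall>\<mu>\<in>P2. m \<le> risk l h S \<mu>"
proof -
  have "compact (l ` {-1..1})"
    using loss_continuous by (intro compact_continuous_image) auto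
  then obtain m where m: "\<And>u. u \<in> {-1..1} \<Longrightarrow> m \<le> l u"
    by (meson bdd_below.E bounded_imp_bdd_below compact_imp_bounded imageI)
  have "m \<le> risk l h S \<mu>" if "\<mu> \<in> P2" for \<mu>
  proof -
    have "emp_avg S (\<lambda>x y. m) \<le> risk l h S \<mu>"
      unfolding risk_def using that by (intro emp_avg_mono m margin_range)
    then show ?thesis by (simp add: emp_avg_const nonempty)
  qed
  then show ?thesis by blast
qed

text \<open>Unbiasedness of the stochastic gradient: the data average passes through the integral
  and the inner product and turns the score into the mean score. Boundedness gives the integrability
  for this exchange.\<close>

lemma emp_avg_integral_inner_score:
  assumes "\<mu> \<in> P2"
  shows "emp_avg S (\<lambda>x y. \<integral>\<theta>. mean_score l h S \<mu> \<theta> \<bullet> score l h \<mu> \<theta> x y \<partial>\<mu>)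
    = sq_norm_mean_score \<mu>"
proof -
  have "integrable \<mu> (\<lambda>\<theta>. mean_score l h S \<mu> \<theta> \<bullet> score l h \<mu> \<theta> x y)"
    if xy: "(x, y) \<in> set S" for x y
  proof (rule P2_integrable_bounded[OF assms])
    show "(\<lambda>\<theta>. mean_score l h S \<mu> \<theta> \<bullet> score l h \<mu> \<theta> x y) \<in> borel_measurable borel"
      using mean_score_measurable score_measurable[OF xy] by measurable
    show "norm (mean_score l h S \<mu> \<theta> \<bullet> score l h \<mu> \<theta> x y) \<le> (L * B) * (L * B)" for \<theta>
    proof -
      have "norm (mean_score l h S \<mu> \<theta> \<bullet> score l h \<mu> \<theta> x y)
          \<le> norm (mean_score l h S \<mu> \<theta>) * norm (score l h \<mu> \<theta> x y)"
        unfolding real_norm_def by (rule Cauchy_Schwarz_ineq2)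
      also have "\<dots> \<le> (L * B) * (L * B)"
        using norm_mean_score_le[OF assms] norm_score_le[OF assms xy] L_nonneg B_nonneg
        by (intro mult_mono) auto
      finally show ?thesis .
    qed
  qed
  then have "emp_avg S (\<lambda>x y. \<integral>\<theta>. mean_score l h S \<mu> \<theta> \<bullet> score l h \<mu> \<theta> x y \<partial>\<mu>)
      = (\<integral>\<theta>. emp_avg S (\<lambda>x y. mean_score l h S \<mu> \<theta> \<bullet> score l h \<mu> \<theta> x y) \<partial>\<mu>)"
    by (rule emp_avg_integral)
  also have "\<dots> = (\<integral>\<theta>. mean_score l h S \<mu> \<theta> \<bullet> mean_score l h S \<mu> \<theta> \<partial>\<mu>)"
    by (simp add: emp_avg_bounded_linear[OF bounded_linear_inner_right] mean_score_def)
  finally show ?thesis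
    by (simp add: power2_L2norm power2_norm_eq_inner)
qed

text \<open>\<open>q\<close> stands for the quadratic form of the matrix function and
  \<open>c\<close> for its upper bound \<open>LamA\<close>.\<close>

lemma expected_descent:
  assumes \<mu>: "\<mu> \<in> P2" and \<eta>: "0 < \<eta>" "\<eta> * (L * B) < r" and c: "0 \<le> c"
    and quad: "\<And>\<theta> v. q \<theta> v \<le> c * (norm v)\<^sup>2"
    and smooth: "\<And>\<xi>. \<xi> \<in> L2 \<mu> \<Longrightarrow> L2norm \<mu> \<xi> < r \<Longrightarrow>
      risk l h S (distr \<mu> borel (\<lambda>\<theta>. \<theta> + \<xi> \<theta>))
      \<le> risk l h S \<mu> + (\<integral>\<theta>. mean_score l h S \<mu> \<theta> \<bullet> \<xi> \<theta> \<partial>\<mu>) + 1/2 * (\<integral>\<theta>. q \<theta> (\<xi> \<theta>) \<partial>\<mu>)"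
  shows "emp_avg S (\<lambda>x y. risk l h S (spgd_step l h \<eta> (x, y) \<mu>))
    \<le> risk l h S \<mu> - \<eta> * sq_norm_mean_score \<mu> + \<eta>\<^sup>2 * (c * (L * B)\<^sup>2 / 2)"
proof -
  let ?I = "\<lambda>x y. \<integral>\<theta>. mean_score l h S \<mu> \<theta> \<bullet> score l h \<mu> \<theta> x y \<partial>\<mu>"
  have step: "risk l h S (spgd_step l h \<eta> (x, y) \<mu>)
      \<le> (risk l h S \<mu> + \<eta>\<^sup>2 * (c * (L * B)\<^sup>2 / 2)) + - \<eta> * ?I x y"
    if xy: "(x, y) \<in> set S" for x y
  proof -
    define \<xi> where "\<xi> \<theta> = - \<eta> *\<^sub>R score l h \<mu> \<theta> x y" for \<theta>
    have [measurable]: "\<xi> \<in> borel_measurable borel"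
      unfolding \<xi>_def[abs_def] using score_measurable[OF xy] by measurable
    \<comment> \<open>This pointwise bound gives membership in \<open>L2\<close>, the norm below
      \<open>r\<close> and the size of the second-order term.\<close>
    have sq: "(norm (\<xi> \<theta>))\<^sup>2 \<le> (\<eta> * (L * B))\<^sup>2" for \<theta>
      unfolding \<xi>_def using norm_score_le[OF \<mu> xy, of \<theta>] \<eta>(1) by (intro power_mono) auto
    have "integrable \<mu> (\<lambda>\<theta>. (norm (\<xi> \<theta>))\<^sup>2)"
      using sq by (intro P2_integrable_bounded[OF \<mu>]) auto
    then have "\<xi> \<in> L2 \<mu>"
      by (simp add: L2_def P2_measurable[OF \<mu>])
    moreover have "L2norm \<mu> \<xi> < r"
    proof -
      have "L2norm \<mu> \<xi> \<le> sqrt ((\<eta> * (L * B))\<^sup>2)"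
        unfolding L2norm_def using sq by (intro real_sqrt_le_mono P2_integral_le[OF \<mu>]) auto
      then show ?thesis using \<eta> L_nonneg B_nonneg by simp
    qed
    moreover have "(\<integral>\<theta>. q \<theta> (\<xi> \<theta>) \<partial>\<mu>) \<le> c * (\<eta> * (L * B))\<^sup>2"
      using c order_trans[OF quad mult_left_mono[OF sq c]]
      by (intro P2_integral_le[OF \<mu>]) auto
    moreover have "(\<integral>\<theta>. mean_score l h S \<mu> \<theta> \<bullet> \<xi> \<theta> \<partial>\<mu>) = - \<eta> * ?I x y"
      by (simp add: \<xi>_def)
    moreover have "spgd_step l h \<eta> (x, y) \<mu> = distr \<mu> borel (\<lambda>\<theta>. \<theta> + \<xi> \<theta>)"
      by (simp add: spgd_step_def \<xi>_def)
    ultimately show ?thesis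
      using smooth[of \<xi>] by (simp add: power_mult_distrib algebra_simps)
  qed
  have "emp_avg S (\<lambda>x y. risk l h S (spgd_step l h \<eta> (x, y) \<mu>))
      \<le> emp_avg S (\<lambda>x y. (risk l h S \<mu> + \<eta>\<^sup>2 * (c * (L * B)\<^sup>2 / 2)) + - \<eta> * ?I x y)"
    using step by (rule emp_avg_mono)
  also have "\<dots> = (risk l h S \<mu> + \<eta>\<^sup>2 * (c * (L * B)\<^sup>2 / 2)) + - \<eta> * sq_norm_mean_score \<mu>"
    unfolding emp_avg_add emp_avg_const[OF nonempty]
      emp_avg_bounded_linear[OF bounded_linear_mult_right]
      emp_avg_integral_inner_score[OF \<mu>] ..
  finally show ?thesis by simp
qed

text \<open>As \<open>\<eta> * g \<le> \<epsilon> / 2\<close>, the noise consumes at most half of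
  the gain from a squared mean score above \<epsilon>: each inaccurate step lowers the expected risk
  by at least \<open>\<eta> * \<epsilon> / 2\<close>.\<close>

lemma exists_accurate_iterate:
  assumes descent: "\<And>\<mu>. \<mu> \<in> P2 \<Longrightarrow> emp_avg S (\<lambda>x y. risk l h S (spgd_step l h \<eta> (x, y) \<mu>))
      \<le> risk l h S \<mu> - \<eta> * sq_norm_mean_score \<mu> + \<eta>\<^sup>2 * g"
    and "0 < \<eta>" "0 < \<epsilon>" "0 < g" "\<eta> \<le> \<epsilon> / (2 * g)" and \<mu>0: "\<mu>0 \<in> P2"
  shows "\<exists>k. real k \<le> 2 * (risk l h S \<mu>0 - (INF \<mu>\<in>P2. risk l h S \<mu>)) / (\<epsilon> * \<eta>)
    \<and> iter_mean l h S \<eta> sq_norm_mean_score k \<mu>0 \<le> \<epsilon>"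
proof -
  define \<Delta> where "\<Delta> = risk l h S \<mu>0 - (INF \<mu>\<in>P2. risk l h S \<mu>)"
  define R where "R k = iter_mean l h S \<eta> (risk l h S) k \<mu>0" for k
  define D where "D k = iter_mean l h S \<eta> sq_norm_mean_score k \<mu>0" for k
  have bdd: "bdd_below (risk l h S ` P2)"
    using risk_bounded_below by (auto intro: bdd_belowI2)
  have inf_le: "(INF \<mu>\<in>P2. risk l h S \<mu>) \<le> R k" for k
    using iter_mean_mono[of P2 S l h \<eta> "\<lambda>_. INF \<mu>\<in>P2. risk l h S \<mu>" "risk l h S" \<mu>0 k]
      spgd_step_in_P2 cINF_lower[OF bdd] \<mu>0
    by (simp add: R_def iter_mean_const nonempty)
  have step: "R (Suc k) \<le> R k - \<eta> * D k + \<eta> * (\<epsilon> / 2)" for k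
  proof -
    \<comment> \<open>The one-step estimate is applied to the last step and then averaged over the
      first \<open>k\<close> samples.\<close>
    have "R (Suc k)
        \<le> iter_mean l h S \<eta> (\<lambda>\<mu>. risk l h S \<mu> + (- \<eta> * sq_norm_mean_score \<mu> + \<eta>\<^sup>2 * g)) k \<mu>0"
      unfolding R_def iter_mean_Suc
    proof (rule iter_mean_mono[of P2])
      show "emp_avg S (\<lambda>x y. risk l h S (spgd_step l h \<eta> (x, y) \<mu>))
          \<le> risk l h S \<mu> + (- \<eta> * sq_norm_mean_score \<mu> + \<eta>\<^sup>2 * g)" if "\<mu> \<in> P2" for \<mu>
        using descent[OF that] by simp
    qed (use spgd_step_in_P2 \<mu>0 in auto)
    also have "\<dots> = R k - \<eta> * D k + \<eta> * (\<eta> * g)"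
      unfolding iter_mean_add iter_mean_mult iter_mean_const[OF nonempty] R_def D_def
      by (simp add: power2_eq_square)
    also have "\<dots> \<le> R k - \<eta> * D k + \<eta> * (\<epsilon> / 2)"
      using assms(2-5) by (simp add: field_simps)
    finally show ?thesis .
  qed
  have telescope: "R K \<le> R 0 - real K * (\<eta> * \<epsilon> / 2)" if "\<And>k. k < K \<Longrightarrow> \<epsilon> < D k" for K
    using that
  proof (induction K)
    case (Suc K)
    have "\<eta> * \<epsilon> \<le> \<eta> * D K"
      using Suc.prems[of K] \<open>0 < \<eta>\<close> by simp
    then show ?case
      using Suc.IH[OF Suc.prems[OF less_SucI]] step[of K]
      by (simp add: algebra_simps add_divide_distrib)
  qed simp
  \<comment> \<open>The largest integer within the iteration budget, so that \<open>Suc K\<close>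
    exceeds it.\<close>
  define K where "K = nat \<lfloor>2 * \<Delta> / (\<epsilon> * \<eta>)\<rfloor>"
  \<comment> \<open>Rules out truncation by \<open>nat\<close>.\<close>
  have "0 \<le> \<Delta>"
    using inf_le[of 0] by (simp add: \<Delta>_def R_def)
  then have K: "real K \<le> 2 * \<Delta> / (\<epsilon> * \<eta>)" "2 * \<Delta> / (\<epsilon> * \<eta>) < real (Suc K)"
    using assms(2,3) unfolding K_def by (simp_all add: of_nat_floor) linarith
  have "\<exists>k\<le>K. D k \<le> \<epsilon>"
  proof (rule ccontr)
    assume "\<not> (\<exists>k\<le>K. D k \<le> \<epsilon>)"
    \<comment> \<open>The indices from 0 to \<open>K\<close> are \<open>Suc K\<close> inaccurate
      steps, whose total decrease would exceed \<open>\<Delta>\<close>.\<close>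
    then have "R (Suc K) \<le> R 0 - real (Suc K) * (\<eta> * \<epsilon> / 2)"
      by (intro telescope) (meson less_Suc_eq_le not_le)
    then have "real (Suc K) * (\<eta> * \<epsilon> / 2) \<le> \<Delta>"
      using inf_le[of "Suc K"] by (simp add: \<Delta>_def R_def)
    then show False
      using K(2) assms(2,3) by (simp add: field_simps)
  qed
  then show ?thesis
    using K(1) unfolding \<Delta>_def D_def by (meson of_nat_mono order_trans)
qed

end

section \<open>Choice of the constants and conclusion\<close>

theorem theorem7:
  "\<exists>G \<eta>0 :: real \<times> real \<times> real \<times> real \<Rightarrow> real \<Rightarrow> real \<Rightarrow> real \<Rightarrow> real.
   \<forall>(X :: (real^'n) set) (h :: real^'d \<Rightarrow> real^'n \<Rightarrow> real) (l :: real \<Rightarrow> real)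
     (S :: ((real^'n) \<times> real) list)
     (A :: (real^'d) measure \<Rightarrow> real^'d \<Rightarrow> real^'d^'d) r lamA LamA.
     X \<in> sets borel \<longrightarrow>
     (\<lambda>(\<theta>, x). h \<theta> x) \<in> borel_measurable (borel \<Otimes>\<^sub>M restrict_space borel X) \<longrightarrow>
     (\<forall>\<theta>. \<forall>x\<in>X. h \<theta> x \<in> {-1..1}) \<longrightarrow>
     (\<forall>\<theta>. continuous_on X (h \<theta>)) \<longrightarrow>
     S \<noteq> [] \<longrightarrow>
     set S \<subseteq> X \<times> {-1, 1} \<longrightarrow>
     C_diff 2 l \<longrightarrow>
     (\<forall>x\<in>X. C_diff 2 (\<lambda>\<theta>. h \<theta> x)) \<longrightarrow>
     (\<exists>B. \<forall>\<theta>. \<forall>x\<in>X. norm (grad (\<lambda>t. h t x) \<theta>) \<le> B) \<longrightarrow>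
     (\<exists>B. \<forall>\<theta>. \<forall>x\<in>X. norm (hess (\<lambda>t. h t x) \<theta>) \<le> B) \<longrightarrow>
     (\<exists>B. \<forall>\<theta>. \<forall>x\<in>X. \<forall>c. eigenvalue (hess (\<lambda>t. h t x) \<theta>) c \<longrightarrow> \<bar>c\<bar> \<le> B) \<longrightarrow>
     0 < r \<longrightarrow>
     0 < lamA \<longrightarrow>
     lamA \<le> LamA \<longrightarrow>
     (\<forall>\<mu>\<in>P2. smooth (A \<mu>) \<and>
        (\<forall>\<theta>. pos_def (A \<mu> \<theta>) \<and> mat lamA \<preceq>\<^sub>L A \<mu> \<theta> \<and> A \<mu> \<theta> \<preceq>\<^sub>L mat LamA)) \<longrightarrow>
     (\<forall>\<mu>\<in>P2. \<forall>\<xi>\<in>L2 \<mu>. L2norm \<mu> \<xi> < r \<longrightarrow>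
        risk l h S (distr \<mu> borel (\<lambda>\<theta>. \<theta> + \<xi> \<theta>))
        \<le> risk l h S \<mu> + (\<integral>\<theta>. mean_score l h S \<mu> \<theta> \<bullet> \<xi> \<theta> \<partial>\<mu>)
          + 1/2 * (\<integral>\<theta>. \<xi> \<theta> \<bullet> (A \<mu> \<theta> *v \<xi> \<theta>) \<partial>\<mu>)) \<longrightarrow>
     (let b = regularity_bounds l h X; g = G b lamA LamA r; e0 = \<eta>0 b lamA LamA r in
        0 < g \<and> 0 < e0 \<and>
        (\<forall>\<mu>\<in>P2. \<forall>\<eta>. 0 < \<eta> \<and> \<eta> < e0 \<longrightarrow>
           (\<integral>z. risk l h S (spgd_step l h \<eta> z \<mu>) \<partial>measure_pmf (sample_pmf S))
           \<le> risk l h S \<mu> - \<eta> * (L2norm \<mu> (mean_score l h S \<mu>))\<^sup>2 + \<eta>\<^sup>2 * g) \<and>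
        (\<forall>\<epsilon> \<eta>. \<forall>\<mu>0\<in>P2. 0 < \<epsilon> \<and> 0 < \<eta> \<and> \<eta> \<le> min e0 (\<epsilon> / (2 * g)) \<longrightarrow>
           (\<exists>k. real k \<le> 2 * (risk l h S \<mu>0 - (INF \<mu>\<in>P2. risk l h S \<mu>)) / (\<epsilon> * \<eta>) \<and>
                (\<integral>\<omega>. (L2norm (spgd l h (\<lambda>_. \<eta>) \<mu>0 \<omega> k)
                         (mean_score l h S (spgd l h (\<lambda>_. \<eta>) \<mu>0 \<omega> k)))\<^sup>2 \<partial>sample_space S)
                \<le> \<epsilon>)))"
proof -
  \<comment> \<open>The summand 1 keeps the constant positive even when \<open>L * B\<close>
    vanishes.\<close>
  define G0 :: "real \<times> real \<times> real \<times> real \<Rightarrow> real \<Rightarrow> real \<Rightarrow> real \<Rightarrow> real"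
    where "G0 = (\<lambda>(L, _, B, _) lamA LamA r. LamA * (L * B)\<^sup>2 / 2 + 1)"
  \<comment> \<open>The absolute value keeps the denominator positive for every tuple of reals and
    disappears at the actual bounds. The summand 1 makes \<open>\<eta> * (L * B) < r\<close> strict
    even at \<open>\<eta> = e0\<close>.\<close>
  define E0 :: "real \<times> real \<times> real \<times> real \<Rightarrow> real \<Rightarrow> real \<Rightarrow> real \<Rightarrow> real"
    where "E0 = (\<lambda>(L, _, B, _) lamA LamA r. r / (\<bar>L * B\<bar> + 1))"
  show ?thesis
  proof (rule exI[of _ G0], rule exI[of _ E0], intro allI impI, goal_cases)
    case prems: (1 X h l S A r lamA LamA)
    note nonempty = prems(5) and data = prems(6) and l = prems(7) and h = prems(8)[rule_format]
      and r = prems(12) and A = prems(15) and smooth = prems(16)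
    define L where "L = (SUP u\<in>{-1..1}. \<bar>deriv l u\<bar>)"
    define B where "B = (SUP (\<theta>, x)\<in>UNIV \<times> X. norm (grad (\<lambda>t. h t x) \<theta>))"
    define g where "g = LamA * (L * B)\<^sup>2 / 2 + 1"
    define e0 where "e0 = r / (L * B + 1)"
    have in_X: "x \<in> X" "y \<in> {-1, 1}" if "(x, y) \<in> set S" for x y
      using data that by auto
    have "compact ((\<lambda>u. \<bar>deriv l u\<bar>) ` {-1..1})"
      by (intro compact_continuous_image continuous_on_rabs C_diff_2_continuous_on_deriv l) simp
    then have L_upper: "\<bar>deriv l u\<bar> \<le> L" if "u \<in> {-1..1}" for u
      unfolding L_def using that
      by (intro cSUP_upper bounded_imp_bdd_above compact_imp_bounded)
    obtain B' where B': "\<And>\<theta> x. x \<in> X \<Longrightarrow> norm (grad (\<lambda>t. h t x) \<theta>) \<le> B'"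
      using prems(9) by blast
    have "bdd_above ((\<lambda>(\<theta>, x). norm (grad (\<lambda>t. h t x) \<theta>)) ` (UNIV \<times> X))"
      using B' by (intro bdd_aboveI2[where M=B']) auto
    then have B_upper: "norm (grad (\<lambda>t. h t x) \<theta>) \<le> B" if "x \<in> X" for x \<theta>
      unfolding B_def using cSUP_upper[of "(\<theta>, x)" "UNIV \<times> X"] that by fastforce
    interpret bounded_score l h S L B
    proof
      \<comment> \<open>At a fixed data point the gradient is continuous in \<theta>, hence
        Borel.\<close>
      show "grad (\<lambda>t. h t x) \<in> borel_measurable borel" if "(x, y) \<in> set S" for x y
        using h[OF in_X(1)[OF that]]
        by (intro borel_measurable_continuous_onI C_diff_2_continuous_on_grad)
      show "h \<theta> x \<in> {-1..1}" if "(x, y) \<in> set S" for x y \<theta>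
        using prems(3) in_X(1)[OF that] by blast
    qed (use nonempty in_X B_upper L_upper C_diff_2_continuous_on[OF l] in blast)+
    have LB: "0 \<le> L * B"
      using L_nonneg B_nonneg by simp
    have LamA: "0 < LamA" using prems(13,14) by simp
    have g: "0 < g" "LamA * (L * B)\<^sup>2 / 2 \<le> g"
      unfolding g_def using LamA by (simp_all add: add_nonneg_pos)
    have e0: "0 < e0" unfolding e0_def using r LB by simp
    \<comment> \<open>The endpoint \<open>\<eta> = e0\<close> is included because the claim on the
      iteration allows it.\<close>
    have descent: "emp_avg S (\<lambda>x y. risk l h S (spgd_step l h \<eta> (x, y) \<mu>))
        \<le> risk l h S \<mu> - \<eta> * sq_norm_mean_score \<mu> + \<eta>\<^sup>2 * g"
      if \<mu>: "\<mu> \<in> P2" and \<eta>: "0 < \<eta>" "\<eta> \<le> e0" for \<mu> \<eta>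
    proof -
      have "\<eta> * (L * B) \<le> e0 * (L * B)"
        using \<eta> LB by (intro mult_right_mono)
      also have "\<dots> < r"
        unfolding e0_def using r LB by (simp add: field_simps)
      finally have "emp_avg S (\<lambda>x y. risk l h S (spgd_step l h \<eta> (x, y) \<mu>))
          \<le> risk l h S \<mu> - \<eta> * sq_norm_mean_score \<mu> + \<eta>\<^sup>2 * (LamA * (L * B)\<^sup>2 / 2)"
        using A \<mu> \<eta>(1) LamA smooth
        by (intro expected_descent[where r=r and q="\<lambda>\<theta> v. v \<bullet> (A \<mu> \<theta> *v v)"]
            loewner_le_mat_inner) auto
      also have "\<dots> \<le> risk l h S \<mu> - \<eta> * sq_norm_mean_score \<mu> + \<eta>\<^sup>2 * g"
        using g(2) by (intro add_left_mono mult_left_mono) auto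
      finally show ?thesis .
    qed
    have G0: "G0 (regularity_bounds l h X) lamA LamA r = g"
      by (simp add: G0_def regularity_bounds_def g_def L_def B_def)
    have E0: "E0 (regularity_bounds l h X) lamA LamA r = e0"
      using LB by (simp add: E0_def regularity_bounds_def e0_def L_def[symmetric] B_def[symmetric])
    show ?case
      unfolding Let_def G0 E0 integral_sample_pmf[OF nonempty]
    proof (intro conjI allI ballI impI)
      fix \<epsilon> \<eta> :: real and \<mu>0 :: "(real^'d) measure"
      assume "\<mu>0 \<in> P2" "0 < \<epsilon> \<and> 0 < \<eta> \<and> \<eta> \<le> min e0 (\<epsilon> / (2 * g))"
      then obtain k where
        k: "real k \<le> 2 * (risk l h S \<mu>0 - (INF \<mu>\<in>P2. risk l h S \<mu>)) / (\<epsilon> * \<eta>)"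
          "iter_mean l h S \<eta> sq_norm_mean_score k \<mu>0 \<le> \<epsilon>"
        using exists_accurate_iterate[of \<eta> g \<epsilon> \<mu>0] descent g(1) by auto
      \<comment> \<open>Squared norms are nonnegative, so the integral over sample sequences is at
        most \<open>iter_mean\<close>.\<close>
      show "\<exists>k. real k \<le> 2 * (risk l h S \<mu>0 - (INF \<mu>\<in>P2. risk l h S \<mu>)) / (\<epsilon> * \<eta>) \<and>
          (\<integral>\<omega>. sq_norm_mean_score (spgd l h (\<lambda>_. \<eta>) \<mu>0 \<omega> k) \<partial>sample_space S) \<le> \<epsilon>"
        using k order_trans[OF integral_spgd_le[OF nonempty, of sq_norm_mean_score l h \<eta> \<mu>0 k]]
        by auto
    qed (use g e0 descent in auto)
  qed
qed

end
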